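(* Let $G=(V,E,A)$ be a mixed graph and let $k$ be a positive integer. If $E \cup A$ can be partitioned into $k$ matching forests, then $E \cup A$ can be partitioned into $k$ matching forests $F_1,\ldots,F_k$ such that $$\bigl|\,|\partial F_i| - |\partial F_j|\,\bigr| \le 2 \quad \text{for every } i,j \in \{1,\ldots,k\}.$$
   Context: A mixed graph $G=(V,E,A)$ consists of a finite vertex set $V$, a set $E$ of undirected edges and a set $A$ of directed edges (arcs). An undirected edge covers a vertex $v$ if $v$ is one of its endpoints; an arc covers $v$ if $v$ is its head. For $F \subseteq E \cup A$, $\partial F \subseteq V$ denotes the set of vertices covered by at least one edge of $F$. A subset $F \subseteq E \cup A$ is a matching forest if the underlying undirected edge set of $F$ (ignoring directions) is a forest and each vertex of $V$ is covered by at most one edge of $F$. Equivalently, $F\cap E$ is a matching, $F \cap A$ is a branching (an arc set whose underlying graph is a forest and in which every vertex has indegree at most one), and no vertex is covered both by $F\cap E$ and by $F \cap A$. *)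

theory Defs
  imports Main "HOL-Library.Disjoint_Sets"
begin

text \<open>
  Undirected edges and arcs are abstract objects with incidence functions, so that parallel edges
  are allowed, and so that an undirected edge and an arc, or two opposite arcs, on the same pair of
  vertices remain different edges of the underlying undirected graph.
\<close>

record ('v, 'e) mixed_graph =
  verts :: "'v set"
  edges :: "'e set"
  arcs :: "'e set"
  ends :: "'e \<Rightarrow> 'v set"
  tail :: "'e \<Rightarrow> 'v"
  head :: "'e \<Rightarrow> 'v"

text \<open>Loops are not excluded; as they are cycles of length one, no forest contains one.\<close>

locale wf_mixed_graph =
  fixes G :: "('v, 'e) mixed_graph"
  assumes finite_verts: "finite (verts G)"
    and edges_arcs_disjoint: "edges G \<inter> arcs G = {}"
    and ends_subset: "e \<in> edges G \<Longrightarrow> ends G e \<subseteq> verts G"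
    and card_ends: "e \<in> edges G \<Longrightarrow> card (ends G e) \<in> {1, 2}"
    and tail_in_verts: "a \<in> arcs G \<Longrightarrow> tail G a \<in> verts G"
    and head_in_verts: "a \<in> arcs G \<Longrightarrow> head G a \<in> verts G"

definition covers :: "('v, 'e) mixed_graph \<Rightarrow> 'e \<Rightarrow> 'v \<Rightarrow> bool" where
  "covers G e v \<longleftrightarrow> (e \<in> edges G \<and> v \<in> ends G e) \<or> (e \<in> arcs G \<and> v = head G e)"

definition covered_verts :: "('v, 'e) mixed_graph \<Rightarrow> 'e set \<Rightarrow> 'v set" where
  "covered_verts G F = {v \<in> verts G. \<exists>e\<in>F. covers G e v}"

definition underlying_ends :: "('v, 'e) mixed_graph \<Rightarrow> 'e \<Rightarrow> 'v set" where
  "underlying_ends G e = (if e \<in> edges G then ends G e else {tail G e, head G e})"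

text \<open>
  A cycle with edges \<open>es\<close> and vertices \<open>vs\<close>: the \<open>i\<close>-th edge joins the \<open>i\<close>-th vertex to the next
  one, cyclically. Length one is a loop and length two a pair of distinct parallel edges.
\<close>

definition underlying_cycle :: "('v, 'e) mixed_graph \<Rightarrow> 'e list \<Rightarrow> 'v list \<Rightarrow> bool" where
  "underlying_cycle G es vs \<longleftrightarrow>
     es \<noteq> [] \<and> length vs = length es \<and> distinct es \<and> distinct vs \<and>
     (\<forall>i < length es. underlying_ends G (es ! i) = {vs ! i, vs ! (Suc i mod length es)})"

definition underlying_forest :: "('v, 'e) mixed_graph \<Rightarrow> 'e set \<Rightarrow> bool" where
  "underlying_forest G F \<longleftrightarrow> (\<nexists>es vs. set es \<subseteq> F \<and> underlying_cycle G es vs)"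

definition matching_forest :: "('v, 'e) mixed_graph \<Rightarrow> 'e set \<Rightarrow> bool" where
  "matching_forest G F \<longleftrightarrow>
     F \<subseteq> edges G \<union> arcs G \<and> underlying_forest G F \<and>
     (\<forall>v\<in>verts G. \<forall>e\<in>F. \<forall>f\<in>F. covers G e v \<longrightarrow> covers G f v \<longrightarrow> e = f)"

text \<open>Being the empty set is allowed for a class \<open>F i\<close>.\<close>

definition matching_forest_partition ::
    "('v, 'e) mixed_graph \<Rightarrow> nat \<Rightarrow> (nat \<Rightarrow> 'e set) \<Rightarrow> bool" where
  "matching_forest_partition G k F \<longleftrightarrow>
     (\<forall>i\<in>{1..k}. matching_forest G (F i)) \<and>
     disjoint_family_on F {1..k} \<and> (\<Union>i\<in>{1..k}. F i) = edges G \<union> arcs G"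

end

theory Submission
  imports Defs
begin

text \<open>
  The sum of the numbers \<open>|\<partial>F\<^sub>i|\<close> is the same for all partitions, so it suffices to bring two forests
  with \<open>|\<partial>F\<^sub>1| \<ge> |\<partial>F\<^sub>2| + 3\<close> strictly closer to each other: a partition minimising the sum of
  squares is then as required. For such a pair, let \<open>R\<^sub>i\<close> be the vertices that are not heads of arcs of
  \<open>F\<^sub>i\<close>. Consider the graph whose edges are the undirected edges of both forests together with an edge
  joining a vertex of \<open>R\<^sub>1\<close> to one of \<open>R\<^sub>2\<close> in every minimal vertex set \<open>K\<close> without entering arcs and
  with \<open>R\<^sub>1 \<inter> R\<^sub>2 \<inter> K = {}\<close>. Its components are paths and cycles, and only ends of paths are covered by
  exactly one of the two forests. Hence some component \<open>X\<close> has one or two more vertices in \<open>\<partial>F\<^sub>1\<close> than in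
  \<open>\<partial>F\<^sub>2\<close>. Exchange the undirected edges and the root sets inside \<open>X\<close>. The new root sets still meet every
  set without entering arcs, so by Edmonds' theorem the arcs can be repartitioned into two branchings
  with these root sets. This moves \<open>|\<partial>F\<^sub>1|\<close> and \<open>|\<partial>F\<^sub>2|\<close> by one or two towards each other.
\<close>

section \<open>Disjoint branchings with given root sets\<close>

definition entering :: "('e \<Rightarrow> 'v) \<Rightarrow> ('e \<Rightarrow> 'v) \<Rightarrow> 'e set \<Rightarrow> 'v set \<Rightarrow> 'e set" where
  "entering t h B U = {a \<in> B. h a \<in> U \<and> t a \<notin> U}"

text \<open>Acyclicity is expressed as a cut condition: every vertex is reachable from \<open>R\<close> along \<open>B\<close>.\<close>

definition rooted_branching ::
    "('e \<Rightarrow> 'v) \<Rightarrow> ('e \<Rightarrow> 'v) \<Rightarrow> 'v set \<Rightarrow> 'v set \<Rightarrow> 'e set \<Rightarrow> bool" where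
  "rooted_branching t h V R B \<longleftrightarrow>
     bij_betw h B (V - R) \<and> (\<forall>U. U \<subseteq> V - R \<longrightarrow> U \<noteq> {} \<longrightarrow> entering t h B U \<noteq> {})"

lemma finite_entering: "finite B \<Longrightarrow> finite (entering t h B U)"
  by (simp add: entering_def)

text \<open>An arc entering \<open>U \<inter> W\<close> or \<open>U \<union> W\<close> enters
  \<open>U\<close> or \<open>W\<close>, and an arc entering both of the former enters both of the
  latter.\<close>

lemma card_entering_submodular:
  assumes "finite A"
  shows "card (entering t h A (U \<inter> W)) + card (entering t h A (U \<union> W))
    \<le> card (entering t h A U) + card (entering t h A W)"
proof -
  let ?e = "entering t h A"
  have fin: "finite (?e X)" for X by (simp add: assms finite_entering)
  have "card (?e (U \<inter> W)) + card (?e (U \<union> W))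
      = card (?e (U \<inter> W) \<union> ?e (U \<union> W)) + card (?e (U \<inter> W) \<inter> ?e (U \<union> W))"
    by (rule card_Un_Int) (simp_all add: fin)
  also have "\<dots> \<le> card (?e U \<union> ?e W) + card (?e U \<inter> ?e W)"
    by (intro add_mono card_mono) (simp_all add: fin, auto simp: entering_def)
  also have "\<dots> = card (?e U) + card (?e W)"
    by (rule card_Un_Int[symmetric]) (simp_all add: fin)
  finally show ?thesis .
qed

text \<open>A root set avoids the union iff it avoids both sets, and it avoids the intersection as
  soon as it avoids one of them. If \<open>R j\<close> meets \<open>U\<close> and \<open>W\<close>
  but not their common part, \<open>j\<close> is counted for the intersection only, which makes the
  inequality strict.\<close>

lemma card_avoiding_supermodular:
  assumes "finite I"
  shows "card {i \<in> I. R i \<inter> U = {}} + card {i \<in> I. R i \<inter> W = {}}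
      \<le> card {i \<in> I. R i \<inter> (U \<inter> W) = {}} + card {i \<in> I. R i \<inter> (U \<union> W) = {}}" (is ?le)
    and "\<lbrakk>j \<in> I; R j \<inter> (U \<inter> W) = {}; R j \<inter> U \<noteq> {}; R j \<inter> W \<noteq> {}\<rbrakk> \<Longrightarrow>
      card {i \<in> I. R i \<inter> U = {}} + card {i \<in> I. R i \<inter> W = {}}
      < card {i \<in> I. R i \<inter> (U \<inter> W) = {}} + card {i \<in> I. R i \<inter> (U \<union> W) = {}}" (is "PROP ?less")
proof -
  let ?Z = "\<lambda>U. {i \<in> I. R i \<inter> U = {}}"
  have fin: "finite (?Z X)" for X by (simp add: assms)
  have eq: "card (?Z U) + card (?Z W) = card (?Z U \<union> ?Z W) + card (?Z (U \<union> W))"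
    by (subst card_Un_Int) (auto simp: fin Int_Un_distrib intro!: arg_cong[where f = card])
  show ?le
    unfolding eq by (intro add_right_mono card_mono) (auto simp: fin)
  show "PROP ?less"
  proof -
    assume j: "j \<in> I" "R j \<inter> (U \<inter> W) = {}" "R j \<inter> U \<noteq> {}" "R j \<inter> W \<noteq> {}"
    have "j \<in> ?Z (U \<inter> W)" "j \<notin> ?Z U \<union> ?Z W" using j by auto
    moreover have "?Z U \<union> ?Z W \<subseteq> ?Z (U \<inter> W)" by auto
    ultimately have "?Z U \<union> ?Z W \<subset> ?Z (U \<inter> W)" by blast
    then show ?thesis
      unfolding eq by (intro add_strict_right_mono psubset_card_mono) (auto simp: fin)
  qed
qed

text \<open>
  Lovasz's proof: an arc is moved from the supply \<open>A\<close> into the \<open>j\<close>-th branching, its head becoming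
  a root. Choosing the arc inside a minimal tight set that is split by \<open>R j\<close> preserves the cut
  condition.
\<close>

theorem edmonds_disjoint_branchings:
  fixes t h :: "'e \<Rightarrow> 'v" and R :: "'i \<Rightarrow> 'v set"
  assumes "finite V" "finite I" "finite A"
    and "\<And>a. a \<in> A \<Longrightarrow> t a \<in> V \<and> h a \<in> V"
    and "\<And>i. i \<in> I \<Longrightarrow> R i \<subseteq> V"
    and "\<And>U. \<lbrakk>U \<subseteq> V; U \<noteq> {}\<rbrakk> \<Longrightarrow> card {i \<in> I. R i \<inter> U = {}} \<le> card (entering t h A U)"
  shows "\<exists>B. (\<forall>i\<in>I. B i \<subseteq> A \<and> rooted_branching t h V (R i) (B i)) \<and> disjoint_family_on B I"
  using assms(3-)
proof (induction "\<Sum>i\<in>I. card (V - R i)" arbitrary: A R rule: less_induct)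
  case less
  note R = less.prems(3) and cut = less.prems(4)
  show ?case
  proof (cases "\<forall>i\<in>I. R i = V")
    case True
    then show ?thesis
      by (intro exI[of _ "\<lambda>_. {}"]) (auto simp: rooted_branching_def disjoint_family_on_def bij_betw_def)
  next
    case False
    then obtain j where j: "j \<in> I" "R j \<noteq> V" by auto
    let ?p = "\<lambda>R U. card {i \<in> I. R i \<inter> U = {}}"
    define tight where "tight W \<longleftrightarrow> W \<subseteq> V \<and> W \<inter> R j \<noteq> {} \<and> W - R j \<noteq> {} \<and>
      card (entering t h A W) = ?p R W" for W
    have V: "V \<noteq> {}" "R j \<subseteq> V" using j R by auto
    \<comment> \<open>\<open>V\<close> is a first tight set: no arc enters it, so by the cut
      condition no root set avoids it.\<close>
    have entV: "entering t h A V = {}" using less.prems(2) by (auto simp: entering_def)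
    have "?p R V = 0"
      using cut[OF _ V(1)] entV by simp
    moreover have "V \<inter> R j \<noteq> {}"
      using calculation j(1) \<open>finite I\<close> by auto
    ultimately have "tight V"
      using j V entV unfolding tight_def by simp
    then obtain W where W: "tight W" and min: "\<And>W'. tight W' \<Longrightarrow> card W \<le> card W'"
      using ex_has_least_nat[of tight V card] by blast
    \<comment> \<open>\<open>R j\<close> meets \<open>W\<close> but avoids \<open>W - R j\<close>,
      so more root sets avoid the latter. Hence some arc enters \<open>W - R j\<close> without
      entering \<open>W\<close>, that is, it starts in \<open>W \<inter> R j\<close>.\<close>
    have "card (entering t h A W) < ?p R (W - R j)"
    proof -
      have psub: "{i \<in> I. R i \<inter> W = {}} \<subset> {i \<in> I. R i \<inter> (W - R j) = {}}"
        using W j(1) by (auto simp: tight_def)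
      show ?thesis
        using psubset_card_mono[OF _ psub] W \<open>finite I\<close> by (simp add: tight_def)
    qed
    also have "\<dots> \<le> card (entering t h A (W - R j))"
      using W by (intro cut) (auto simp: tight_def)
    finally have "\<not> entering t h A (W - R j) \<subseteq> entering t h A W"
      using card_mono[OF finite_entering[OF less.prems(1)]] by (metis not_le)
    then obtain a where a: "a \<in> A" "h a \<in> W" "h a \<notin> R j" "t a \<in> W" "t a \<in> R j"
      by (auto simp: entering_def)
    define R' where "R' = R(j := insert (h a) (R j))"
    have haV: "h a \<in> V" using a W by (auto simp: tight_def)
    have "\<exists>B. (\<forall>i\<in>I. B i \<subseteq> A - {a} \<and> rooted_branching t h V (R' i) (B i)) \<and>
        disjoint_family_on B I"
    proof (rule less.hyps)
      show "(\<Sum>i\<in>I. card (V - R' i)) < (\<Sum>i\<in>I. card (V - R i))"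
      proof (rule sum_strict_mono_ex1)
        show "\<forall>i\<in>I. card (V - R' i) \<le> card (V - R i)"
          using \<open>finite V\<close> by (auto simp: R'_def intro!: card_mono)
        have "V - R' j \<subset> V - R j" using a haV by (auto simp: R'_def)
        then show "\<exists>i\<in>I. card (V - R' i) < card (V - R i)"
          using j \<open>finite V\<close> by (intro bexI[of _ j] psubset_card_mono) auto
      qed (rule \<open>finite I\<close>)
      show "finite (A - {a})" using less.prems(1) by simp
      show "t b \<in> V \<and> h b \<in> V" if "b \<in> A - {a}" for b using that less.prems(2) by blast
      show "R' i \<subseteq> V" if "i \<in> I" for i using R[OF that] haV by (auto simp: R'_def)
      show "?p R' U \<le> card (entering t h (A - {a}) U)" if U: "U \<subseteq> V" "U \<noteq> {}" for U
      proof (cases "a \<in> entering t h A U")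
        case False
        have "?p R' U \<le> ?p R U"
          using \<open>finite I\<close> by (intro card_mono) (auto simp: R'_def split: if_splits)
        moreover have "entering t h (A - {a}) U = entering t h A U"
          using False by (auto simp: entering_def)
        ultimately show ?thesis using cut[OF U] by simp
      next
        case True
        then have au: "h a \<in> U" "t a \<notin> U" by (auto simp: entering_def)
        have ce: "card (entering t h (A - {a}) U) = card (entering t h A U) - 1"
        proof -
          have "entering t h (A - {a}) U = entering t h A U - {a}"
            by (auto simp: entering_def)
          then show ?thesis using True by (simp add: card_Diff_singleton)
        qed
        show ?thesis
        proof (cases "R j \<inter> U = {}")
          case avoid: True
          \<comment> \<open>Both sides of the cut condition drop by one, since \<open>R' j\<close>
            contains \<open>h a\<close>.\<close>
          have "{i \<in> I. R' i \<inter> U = {}} = {i \<in> I. R i \<inter> U = {}} - {j}"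
            using au by (auto simp: R'_def split: if_splits)
          then have "?p R' U = ?p R U - 1"
            using avoid j by (simp add: card_Diff_singleton)
          then show ?thesis using cut[OF U] ce by simp
        next
          case meet: False
          have p: "?p R' U = ?p R U"
            using au meet by (intro arg_cong[where f = card]) (auto simp: R'_def split: if_splits)
          \<comment> \<open>Only the supply drops here, so slack is needed. Equality at
            \<open>U\<close> would by uncrossing with \<open>W\<close> force equality at
            \<open>U \<inter> W\<close>. If \<open>R j\<close> avoids \<open>U \<inter> W\<close>,
            strict supermodularity is contradicted; otherwise \<open>U \<inter> W\<close> is tight
            and, lacking \<open>t a\<close>, smaller than \<open>W\<close>.\<close>
          have "card (entering t h A U) \<noteq> ?p R U"
          proof
            assume tU: "card (entering t h A U) = ?p R U"
            have ne: "U \<inter> W \<noteq> {}" "U \<inter> W \<subseteq> V" "U \<union> W \<subseteq> V" "U \<union> W \<noteq> {}"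
              using au a U W by (auto simp: tight_def)
            note sub = card_entering_submodular[OF less.prems(1), of t h U W]
              and sup = card_avoiding_supermodular(1)[OF \<open>finite I\<close>, of R U W]
              and sup' = card_avoiding_supermodular(2)[OF \<open>finite I\<close> j(1), of R U W]
              and cuts = cut[OF ne(2,1)] cut[OF ne(3,4)]
            have tW: "card (entering t h A W) = ?p R W" "W \<inter> R j \<noteq> {}" "W \<subseteq> V"
              using W by (auto simp: tight_def)
            have eq: "card (entering t h A (U \<inter> W)) = ?p R (U \<inter> W)"
              using sub sup cuts tU tW(1) by linarith
            show False
            proof (cases "R j \<inter> (U \<inter> W) = {}")
              case True
              then show False
                using sub sup' cuts tU tW meet by (simp add: Int_commute)
            next
              case False
              then have "tight (U \<inter> W)"
                using ne eq a au by (auto simp: tight_def)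
              then have "card W \<le> card (U \<inter> W)" by (rule min)
              moreover have "U \<inter> W \<subset> W" using a au by auto
              ultimately show False
                using psubset_card_mono[of W "U \<inter> W"] finite_subset[OF tW(3) \<open>finite V\<close>] by auto
            qed
          qed
          then show ?thesis using cut[OF U] ce p by linarith
        qed
      qed
    qed
    then obtain B where B: "\<And>i. i \<in> I \<Longrightarrow> B i \<subseteq> A - {a}"
        "\<And>i. i \<in> I \<Longrightarrow> rooted_branching t h V (R' i) (B i)"
        and disj: "disjoint_family_on B I"
      by blast
    have Bj: "bij_betw h (B j) (V - R j - {h a})"
      "\<And>U. U \<subseteq> V - R j - {h a} \<Longrightarrow> U \<noteq> {} \<Longrightarrow> entering t h (B j) U \<noteq> {}"
    proof -
      have "V - R' j = V - R j - {h a}" by (auto simp: R'_def)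
      then show "bij_betw h (B j) (V - R j - {h a})"
        "\<And>U. U \<subseteq> V - R j - {h a} \<Longrightarrow> U \<noteq> {} \<Longrightarrow> entering t h (B j) U \<noteq> {}"
        using B(2)[OF j(1)] unfolding rooted_branching_def by auto
    qed
    have "rooted_branching t h V (R j) (insert a (B j))"
      unfolding rooted_branching_def
    proof (intro conjI allI impI)
      have "insert (h a) (V - R j - {h a}) = V - R j" using haV a by auto
      moreover have "a \<notin> B j" using B(1)[OF j(1)] by auto
      ultimately show "bij_betw h (insert a (B j)) (V - R j)"
        using notIn_Un_bij_betw[of a "B j" h "V - R j - {h a}"] Bj(1) by simp
      fix U assume U: "U \<subseteq> V - R j" "U \<noteq> {}"
      \<comment> \<open>If \<open>h a\<close> lies in \<open>U\<close>, then \<open>a\<close> itself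
        enters \<open>U\<close>, as its tail is in \<open>R j\<close>. Otherwise \<open>U\<close>
        avoids \<open>R' j\<close> and the induction hypothesis applies.\<close>
      show "entering t h (insert a (B j)) U \<noteq> {}"
      proof (cases "h a \<in> U")
        case True
        then have "a \<in> entering t h (insert a (B j)) U"
          using U a by (auto simp: entering_def)
        then show ?thesis by blast
      next
        case False
        then have "entering t h (B j) U \<noteq> {}" using U by (intro Bj) auto
        then show ?thesis by (auto simp: entering_def)
      qed
    qed
    moreover have "rooted_branching t h V (R i) (B i)" if "i \<in> I" "i \<noteq> j" for i
      using B(2)[OF that(1)] that by (simp add: R'_def)
    moreover have "disjoint_family_on (B(j := insert a (B j))) I"
      using disj B(1) unfolding disjoint_family_on_def by auto
    ultimately show ?thesis
      using B(1) a(1) by (intro exI[of _ "B(j := insert a (B j))"]) auto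
  qed
qed

section \<open>Components of the exchange graph\<close>

text \<open>
  Connecting one root of each kind inside every minimal set without entering arcs makes the sets
  \<open>X\<close> compatible with all connections safe: swapping the two root sets on \<open>X\<close> keeps both of them
  meeting every set without entering arcs.
\<close>

lemma root_pairs_exist:
  fixes R :: "bool \<Rightarrow> 'v set"
  assumes "finite V"
    and roots: "\<And>U i. \<lbrakk>U \<subseteq> V; U \<noteq> {}; entering t h B U = {}\<rbrakk> \<Longrightarrow> R i \<inter> U \<noteq> {}"
  shows "\<exists>N. disjoint N \<and>
    (\<forall>P\<in>N. \<exists>u\<in>V. \<exists>w\<in>V. P = {u, w} \<and> u \<in> R True - R False \<and> w \<in> R False - R True) \<and>
    (\<forall>X U i. (\<forall>P\<in>N. P \<subseteq> X \<or> P \<inter> X = {}) \<longrightarrow> U \<subseteq> V \<longrightarrow> U \<noteq> {} \<longrightarrow> entering t h B U = {} \<longrightarrow>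
      (R i - X \<union> R (\<not> i) \<inter> X) \<inter> U \<noteq> {})"
proof -
  define source where "source K \<longleftrightarrow> K \<subseteq> V \<and> K \<noteq> {} \<and> entering t h B K = {}" for K
  define minsource where "minsource K \<longleftrightarrow> source K \<and> (\<forall>K'\<subseteq>K. source K' \<longrightarrow> K' = K)" for K
  \<comment> \<open>An arc entering an intersection enters one of the two sets, so sources are
    closed under nonempty intersections.\<close>
  have disj: "K = K'" if "minsource K" "minsource K'" "K \<inter> K' \<noteq> {}" for K K'
  proof -
    have "source (K \<inter> K')"
      using that by (auto simp: minsource_def source_def entering_def)
    then have "K \<inter> K' = K" "K \<inter> K' = K'"
      using that unfolding minsource_def by (meson inf_le1 inf_le2)+
    then show ?thesis by simp
  qed
  have ex_min: "\<exists>K\<subseteq>U. minsource K" if U: "source U" for U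
  proof -
    obtain K where K: "source K \<and> K \<subseteq> U" and min: "\<And>K'. source K' \<and> K' \<subseteq> U \<Longrightarrow> card K \<le> card K'"
      using ex_has_least_nat[of "\<lambda>K. source K \<and> K \<subseteq> U" U card] U by blast
    have "finite K" using K \<open>finite V\<close> finite_subset unfolding source_def by blast
    then have "minsource K"
      using K min unfolding minsource_def by (metis card_seteq order_trans)
    then show ?thesis using K by blast
  qed
  define r where "r K i = (SOME v. v \<in> R i \<inter> K)" for K i
  have r: "r K i \<in> R i \<inter> K" if "source K" for K i
  proof -
    have "\<exists>v. v \<in> R i \<inter> K" using roots[of K i] that unfolding source_def by blast
    then show ?thesis unfolding r_def by (rule someI_ex)
  qed
  \<comment> \<open>The other minimal sources contain a common root, which survives every exchange,
    so they need no pair.\<close>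
  define \<K> where "\<K> = {K. minsource K \<and> R True \<inter> R False \<inter> K = {}}"
  define pair where "pair K = {r K True, r K False}" for K
  have pair: "pair K \<subseteq> K" if "K \<in> \<K>" for K
    using r[of K] that by (auto simp: pair_def \<K>_def minsource_def)
  have "disjoint (pair ` \<K>)"
    unfolding disjoint_def
  proof (intro ballI impI)
    fix P Q assume "P \<in> pair ` \<K>" "Q \<in> pair ` \<K>" "P \<noteq> Q"
    then obtain K K' where K: "K \<in> \<K>" "K' \<in> \<K>" "P = pair K" "Q = pair K'" "K \<noteq> K'" by auto
    then have "K \<inter> K' = {}" using disj unfolding \<K>_def by blast
    then show "P \<inter> Q = {}" using pair K by blast
  qed
  moreover have "\<exists>u\<in>V. \<exists>w\<in>V. P = {u, w} \<and> u \<in> R True - R False \<and> w \<in> R False - R True"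
    if P: "P \<in> pair ` \<K>" for P
  proof -
    obtain K where K: "K \<in> \<K>" "P = pair K" using P by auto
    then have "K \<subseteq> V" "source K" "R True \<inter> R False \<inter> K = {}"
      by (auto simp: \<K>_def minsource_def source_def)
    then show ?thesis
      using r[of K True] r[of K False] K(2)
      by (intro bexI[of _ "r K True"] bexI[of _ "r K False"]) (auto simp: pair_def)
  qed
  moreover have "(R i - X \<union> R (\<not> i) \<inter> X) \<inter> U \<noteq> {}"
    if X: "\<forall>P\<in>pair ` \<K>. P \<subseteq> X \<or> P \<inter> X = {}"
      and U: "U \<subseteq> V" "U \<noteq> {}" "entering t h B U = {}" for X U i
  proof -
    obtain K where K: "K \<subseteq> U" "minsource K" using ex_min[of U] U by (auto simp: source_def)
    show ?thesis
    proof (cases "K \<in> \<K>")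
      case False
      then obtain v where "v \<in> K" "v \<in> R True" "v \<in> R False"
        using K by (auto simp: \<K>_def)
      then have "v \<in> K" "v \<in> R i" "v \<in> R (\<not> i)" by (cases i; simp)+
      then show ?thesis using K by blast
    next
      case True
      \<comment> \<open>If the pair lies inside \<open>X\<close>, then \<open>r K (\<not> i)\<close>
        becomes a root of kind \<open>i\<close>; if outside, \<open>r K i\<close> remains
        one.\<close>
      then have "pair K \<subseteq> X \<or> pair K \<inter> X = {}" using X by blast
      moreover have "r K i \<in> pair K" "r K (\<not> i) \<in> pair K"
        unfolding pair_def by (cases i; simp)+
      moreover have "r K i \<in> R i \<inter> K" "r K (\<not> i) \<in> R (\<not> i) \<inter> K"
        using r K(2) by (auto simp: minsource_def)
      ultimately show ?thesis using K(1) by blast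
    qed
  qed
  ultimately show ?thesis by (intro exI[of _ "pair ` \<K>"]) blast
qed

text \<open>
  If \<open>N\<close> is the edge set of a graph of maximum degree two whose vertices of nonzero weight are ends
  of paths, then a component has at most two of the latter. Components are grown vertex by
  vertex: the number of leaving edges plus the absolute weight collected never exceeds two.
\<close>

lemma closed_set_small_sum:
  fixes s :: "'v \<Rightarrow> int"
  assumes "finite V" "finite N" and two: "\<And>P. P \<in> N \<Longrightarrow> P \<subseteq> V \<and> card P = 2"
    and deg: "\<And>v. v \<in> V \<Longrightarrow> int (card {P \<in> N. v \<in> P}) + \<bar>s v\<bar> \<le> 2"
    and pos: "sum s V > 0"
  shows "\<exists>X\<subseteq>V. (\<forall>P\<in>N. P \<subseteq> X \<or> P \<inter> X = {}) \<and> 0 < sum s X \<and> sum s X \<le> 2"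
proof -
  \<comment> \<open>Removing a nonempty union of components with nonpositive sum from a smallest
    such set would leave a smaller one; this yields \<open>0 < sum s X\<close> at the end.\<close>
  define closed where "closed W \<longleftrightarrow> W \<subseteq> V \<and> (\<forall>P\<in>N. P \<subseteq> W \<or> P \<inter> W = {}) \<and> sum s W > 0" for W
  have "closed V" using two pos by (auto simp: closed_def)
  then obtain W where W: "closed W" and min: "\<And>W'. closed W' \<Longrightarrow> card W \<le> card W'"
    using ex_has_least_nat[of closed V card] by blast
  have WV: "W \<subseteq> V" "finite W" using W \<open>finite V\<close> finite_subset by (auto simp: closed_def)
  have "W \<noteq> {}" using W by (auto simp: closed_def)
  then obtain v0 where v0: "v0 \<in> W" by blast
  define leave where "leave X = {P \<in> N. P \<inter> X \<noteq> {} \<and> \<not> P \<subseteq> X}" for X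
  define grown where "grown X \<longleftrightarrow> X \<subseteq> W \<and> v0 \<in> X \<and>
    int (card (leave X)) + (\<Sum>v\<in>X. \<bar>s v\<bar>) \<le> 2" for X
  have "card (leave {v0}) \<le> card {P \<in> N. v0 \<in> P}"
    using \<open>finite N\<close> by (intro card_mono) (auto simp: leave_def)
  then have "grown {v0}" using deg[of v0] v0 WV by (auto simp: grown_def)
  moreover have "\<forall>X. grown X \<longrightarrow> card X < Suc (card W)"
    using WV by (auto simp: grown_def less_Suc_eq_le intro: card_mono)
  ultimately obtain X where X: "grown X" and max: "\<And>X'. grown X' \<Longrightarrow> card X' \<le> card X"
    using ex_has_greatest_nat[of grown "{v0}" card "Suc (card W)"] by metis
  have XW: "X \<subseteq> W" "finite X" using X WV finite_subset by (auto simp: grown_def)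
  have "leave X = {}"
  proof (rule ccontr)
    assume "leave X \<noteq> {}"
    then obtain P where P: "P \<in> N" "P \<inter> X \<noteq> {}" "\<not> P \<subseteq> X" by (auto simp: leave_def)
    then obtain x v where xv: "x \<in> P" "x \<in> X" "v \<in> P" "v \<notin> X" by blast
    then have "P = {x, v}"
      using two[OF P(1)] by (auto simp: card_2_iff)
    have "P \<subseteq> W" using P W XW by (auto simp: closed_def)
    then have v: "v \<in> W" "v \<in> V" using xv WV by auto
    have PL: "P \<in> leave X" "P \<in> {P \<in> N. v \<in> P}" using P xv by (auto simp: leave_def)
    have fin: "finite (leave X)" "finite {P \<in> N. v \<in> P}"
      using \<open>finite N\<close> by (auto simp: leave_def)
    \<comment> \<open>The edge \<open>P\<close> stops leaving and is counted both in
      \<open>leave X\<close> and at \<open>v\<close>. The resulting saving of two pays for the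
      degree and weight of \<open>v\<close>, by \<open>deg\<close>.\<close>
    have "leave (insert v X) \<subseteq> (leave X - {P}) \<union> ({P \<in> N. v \<in> P} - {P})"
      using \<open>P = {x, v}\<close> xv by (auto simp: leave_def)
    then have "card (leave (insert v X)) \<le> card (leave X - {P}) + card ({P \<in> N. v \<in> P} - {P})"
      using fin by (meson card_Un_le card_mono finite_Diff finite_UnI order_trans)
    also have "\<dots> = (card (leave X) - 1) + (card {P \<in> N. v \<in> P} - 1)"
      using PL by (simp add: card_Diff_singleton)
    finally have "card (leave (insert v X)) \<le>
        (card (leave X) - 1) + (card {P \<in> N. v \<in> P} - 1)" .
    moreover have "card (leave X) > 0" "card {P \<in> N. v \<in> P} > 0"
      unfolding card_gt_0_iff using PL fin by blast+
    ultimately have "int (card (leave (insert v X))) \<le> int (card (leave X)) + int (card {P \<in> N. v \<in> P}) - 2"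
      by linarith
    then have "grown (insert v X)"
      using X deg[OF v(2)] v xv XW by (auto simp: grown_def)
    from max[OF this] show False using xv XW by simp
  qed
  then have Xcl: "\<forall>P\<in>N. P \<subseteq> X \<or> P \<inter> X = {}" by (auto simp: leave_def)
  have "sum s X \<le> (\<Sum>v\<in>X. \<bar>s v\<bar>)" by (intro sum_mono) simp
  also have "\<dots> \<le> 2" using X by (simp add: grown_def)
  finally have le2: "sum s X \<le> 2" .
  have "0 < sum s X"
  proof (rule ccontr)
    assume "\<not> 0 < sum s X"
    then have "sum s (W - X) > 0"
      using sum_diff[OF WV(2) XW(1), of s] W unfolding closed_def by linarith
    moreover have "\<forall>P\<in>N. P \<subseteq> W - X \<or> P \<inter> (W - X) = {}"
      using Xcl W unfolding closed_def by blast
    ultimately have "closed (W - X)" using WV by (auto simp: closed_def)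
    from min[OF this] have "card W \<le> card (W - X)" .
    moreover have "W - X \<subset> W" using X v0 by (auto simp: grown_def)
    ultimately show False using psubset_card_mono[OF WV(2), of "W - X"] by linarith
  qed
  moreover have "X \<subseteq> V" using XW WV by blast
  ultimately show ?thesis using Xcl le2 by (intro exI[of _ X]) simp
qed

text \<open>Written with sums only, to avoid truncated subtraction.\<close>

lemma card_exchange:
  assumes "finite C" "finite D"
  shows "card (C - X \<union> D \<inter> X) + card (C \<inter> X) = card C + card (D \<inter> X)"
proof -
  have "card (C - X \<union> D \<inter> X) = card (C - X) + card (D \<inter> X)"
    using assms by (intro card_Un_disjoint) auto
  then show ?thesis using card_Int_Diff[OF assms(1), of X] by simp
qed

section \<open>Matching forests in terms of cuts\<close>

text \<open>The iterates of a point in a finite set repeat, so some \<open>x\<close> returns to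
  itself. For the least return time \<open>n\<close>, a coincidence at \<open>a < b < n\<close>
  would yield the earlier return time \<open>n - b + a\<close>.\<close>

lemma functional_cycle:
  assumes "finite U" "U \<noteq> {}" and p: "\<And>x. x \<in> U \<Longrightarrow> p x \<in> U"
  shows "\<exists>x\<in>U. \<exists>n>0. (p ^^ n) x = x \<and> inj_on (\<lambda>i. (p ^^ i) x) {..<n}"
proof -
  obtain x0 where x0: "x0 \<in> U" using assms(2) by blast
  have pU: "(p ^^ i) x \<in> U" if "x \<in> U" for i x
    using that p by (induction i) auto
  have "\<not> inj (\<lambda>i. (p ^^ i) x0)"
  proof
    assume "inj (\<lambda>i. (p ^^ i) x0)"
    moreover have "finite (range (\<lambda>i. (p ^^ i) x0))"
      by (rule finite_subset[OF _ assms(1)]) (auto simp: pU x0)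
    ultimately show False using finite_imageD infinite_UNIV_nat by blast
  qed
  then obtain i j where ij: "i < j" "(p ^^ i) x0 = (p ^^ j) x0"
    unfolding inj_def by (metis nat_neq_iff)
  define x where "x = (p ^^ i) x0"
  define n where "n = (LEAST n. n > 0 \<and> (p ^^ n) x = x)"
  have "(p ^^ (j - i)) x = x"
    using ij unfolding x_def by (metis comp_apply funpow_add le_add_diff_inverse2 less_imp_le)
  then have "j - i > 0 \<and> (p ^^ (j - i)) x = x" using ij by simp
  then have n: "n > 0 \<and> (p ^^ n) x = x" unfolding n_def by (rule LeastI)
  have no: "(p ^^ a) x \<noteq> (p ^^ b) x" if "a < b" "b < n" for a b
  proof
    assume eq: "(p ^^ a) x = (p ^^ b) x"
    have "(p ^^ (n - b + a)) x = (p ^^ (n - b)) ((p ^^ b) x)"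
      by (simp add: funpow_add eq)
    also have "\<dots> = (p ^^ (n - b + b)) x" by (simp only: funpow_add comp_apply)
    also have "\<dots> = x" using that n by simp
    finally have "n \<le> n - b + a"
      unfolding n_def by (intro Least_le) (use that in \<open>simp add: n_def[symmetric]\<close>)
    then show False using that by simp
  qed
  have "inj_on (\<lambda>i. (p ^^ i) x) {..<n}"
    using no unfolding inj_on_def by (metis lessThan_iff nat_neq_iff)
  moreover have "x \<in> U" unfolding x_def by (rule pU[OF x0])
  ultimately show ?thesis using n by blast
qed

context wf_mixed_graph
begin

abbreviation V where "V \<equiv> verts G"

lemma underlying_ends_arc: "a \<in> arcs G \<Longrightarrow> underlying_ends G a = {tail G a, head G a}"
  using edges_arcs_disjoint by (auto simp: underlying_ends_def)

lemma covers_arc: "a \<in> arcs G \<Longrightarrow> covers G a v \<longleftrightarrow> v = head G a"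
  using edges_arcs_disjoint by (auto simp: covers_def)

lemma covers_edge: "e \<in> edges G \<Longrightarrow> covers G e v \<longleftrightarrow> v \<in> ends G e"
  using edges_arcs_disjoint by (auto simp: covers_def)

lemma forest_no_loop:
  assumes "underlying_forest G F" "e \<in> F" "e \<in> edges G"
  shows "card (ends G e) = 2"
proof (rule ccontr)
  assume "card (ends G e) \<noteq> 2"
  then obtain v where "ends G e = {v}" using card_ends[OF assms(3)] by (auto simp: card_1_singleton_iff)
  then have "underlying_cycle G [e] [v]"
    using assms(3) by (simp add: underlying_cycle_def underlying_ends_def)
  then show False using assms(1,2) unfolding underlying_forest_def by (metis empty_subsetI insert_subset list.simps(15) set_empty2)
qed

text \<open>If no arc entered \<open>U\<close>, going from each vertex back along an arc into it
  would never leave \<open>U\<close>, and would therefore run into a directed cycle.\<close>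

lemma forest_entering:
  assumes "underlying_forest G F" "U \<noteq> {}" "U \<subseteq> V" and U: "U \<subseteq> head G ` (F \<inter> arcs G)"
  shows "entering (tail G) (head G) (F \<inter> arcs G) U \<noteq> {}"
proof
  assume none: "entering (tail G) (head G) (F \<inter> arcs G) U = {}"
  have "\<forall>v\<in>U. \<exists>b. b \<in> F \<inter> arcs G \<and> head G b = v" using U by auto
  then obtain b where b: "\<And>v. v \<in> U \<Longrightarrow> b v \<in> F \<and> b v \<in> arcs G \<and> head G (b v) = v"
    by (metis IntD1 IntD2)
  define p where "p v = tail G (b v)" for v
  have pU: "p v \<in> U" if "v \<in> U" for v
    using none b[OF that] that by (auto simp: entering_def p_def)
  obtain x n where x: "x \<in> U" and n: "n > 0" "(p ^^ n) x = x" "inj_on (\<lambda>i. (p ^^ i) x) {..<n}"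
    using functional_cycle[of U p] assms(2) finite_subset[OF assms(3) finite_verts] pU by blast
  have xU: "(p ^^ i) x \<in> U" for i using x pU by (induction i) auto
  define vs where "vs = map (\<lambda>i. (p ^^ i) x) [0..<n]"
  have "distinct vs" using n(3) by (simp add: vs_def distinct_map atLeast0LessThan)
  have "inj_on b U" using b by (metis inj_onI)
  moreover have "set vs \<subseteq> U" using xU by (auto simp: vs_def)
  ultimately have "distinct (map b vs)"
    using \<open>distinct vs\<close> by (simp add: distinct_map inj_on_subset)
  moreover have "underlying_ends G (map b vs ! i) = {vs ! i, vs ! (Suc i mod n)}" if "i < n" for i
  proof -
    \<comment> \<open>At the last position the index wraps to \<open>0\<close>, where
      \<open>x = (p ^^ n) x\<close> stands.\<close>
    have "vs ! (Suc i mod n) = p ((p ^^ i) x)"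
    proof (cases "Suc i = n")
      case True
      then show ?thesis using n(1,2) by (auto simp: vs_def)
    next
      case False
      then show ?thesis using that by (simp add: vs_def)
    qed
    moreover have "map b vs ! i = b ((p ^^ i) x)" "vs ! i = (p ^^ i) x"
      using that by (simp_all add: vs_def)
    ultimately show ?thesis
      using b[OF xU[of i]] underlying_ends_arc[of "b ((p ^^ i) x)"] by (auto simp: p_def)
  qed
  ultimately have "underlying_cycle G (map b vs) vs"
    using \<open>distinct vs\<close> n(1) by (simp add: underlying_cycle_def vs_def)
  moreover have "set (map b vs) \<subseteq> F" using b \<open>set vs \<subseteq> U\<close> by auto
  ultimately show False using assms(1) unfolding underlying_forest_def by blast
qed

text \<open>
  A cycle in which every vertex is covered at most once has as many edges as vertices, so each of
  its edges covers exactly one of its vertices and is an arc whose tail also lies on the cycle.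
\<close>

lemma matching_forestI:
  assumes sub: "F \<subseteq> edges G \<union> arcs G"
    and noloop: "\<And>e. \<lbrakk>e \<in> F; e \<in> edges G\<rbrakk> \<Longrightarrow> card (ends G e) = 2"
    and once: "\<And>v e f. \<lbrakk>v \<in> V; e \<in> F; f \<in> F; covers G e v; covers G f v\<rbrakk> \<Longrightarrow> e = f"
    and ent: "\<And>U. \<lbrakk>U \<noteq> {}; U \<subseteq> V; U \<subseteq> head G ` (F \<inter> arcs G)\<rbrakk> \<Longrightarrow>
      entering (tail G) (head G) (F \<inter> arcs G) U \<noteq> {}"
  shows "matching_forest G F"
proof -
  have "\<not> underlying_cycle G es vs" if es: "set es \<subseteq> F" for es vs
  proof
    assume cyc: "underlying_cycle G es vs"
    let ?U = "set vs"
    have len: "es \<noteq> []" "length vs = length es" "distinct es" "distinct vs"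
      and ue: "\<And>i. i < length es \<Longrightarrow>
        underlying_ends G (es ! i) = {vs ! i, vs ! (Suc i mod length es)}"
      using cyc by (auto simp: underlying_cycle_def)
    have ueU: "underlying_ends G e \<subseteq> ?U" if e: "e \<in> set es" for e
    proof -
      obtain i where "i < length es" "e = es ! i" using e by (metis in_set_conv_nth)
      then show ?thesis using ue[of i] len by simp
    qed
    have UV: "?U \<subseteq> V"
    proof
      fix v assume "v \<in> ?U"
      then obtain i where i: "i < length es" "v = vs ! i" using len(2) by (metis in_set_conv_nth)
      moreover have "es ! i \<in> edges G \<union> arcs G"
        using nth_mem[OF i(1)] es sub by blast
      ultimately have "v \<in> underlying_ends G (es ! i)" "es ! i \<in> edges G \<union> arcs G"
        using ue[of i] by auto
      then show "v \<in> V"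
        using ends_subset tail_in_verts head_in_verts by (auto simp: underlying_ends_def split: if_splits)
    qed
    \<comment> \<open>One covered vertex is selected per edge. Since no vertex is covered twice,
      \<open>f\<close> is injective on the cycle, and by counting it is onto the cycle's
      vertices.\<close>
    define f where "f e = (if e \<in> edges G then SOME v. v \<in> ends G e else head G e)" for e
    have f: "f e \<in> ?U" "covers G e (f e)" if "e \<in> set es" for e
    proof -
      have "f e \<in> underlying_ends G e \<and> covers G e (f e)"
      proof (cases "e \<in> edges G")
        case True
        then have "ends G e \<noteq> {}" using card_ends by force
        then show ?thesis
          using True by (auto simp: f_def underlying_ends_def covers_def some_in_eq)
      next
        case False
        then show ?thesis
          using that es sub by (auto simp: f_def underlying_ends_def covers_def)
      qed
      then show "f e \<in> ?U" "covers G e (f e)" using ueU[OF that] by auto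
    qed
    have "inj_on f (set es)"
      using f once es UV by (intro inj_onI) (metis subsetD)
    then have "card (f ` set es) = card ?U"
      using len by (simp add: card_image distinct_card)
    then have onto: "f ` set es = ?U"
      using f by (intro card_subset_eq) auto
    have uniq: "v = f e" if "e \<in> set es" "covers G e v" "v \<in> ?U" for e v
    proof -
      have "v \<in> f ` set es" using onto that(3) by simp
      then obtain e' where "e' \<in> set es" "v = f e'" by blast
      then show ?thesis using once[of v e e'] f es UV that by auto
    qed
    \<comment> \<open>Both ends of an undirected cycle edge would have to be \<open>f e\<close>,
      making it a loop.\<close>
    have arc: "e \<in> arcs G" if e: "e \<in> set es" for e
    proof (rule ccontr)
      assume "e \<notin> arcs G"
      then have eE: "e \<in> edges G" "e \<in> F" using e es sub by auto
      then have "ends G e \<subseteq> {f e}"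
        using uniq[OF e] ueU[OF e] by (auto simp: covers_edge underlying_ends_def)
      then show False using noloop[OF eE(2,1)] card_mono[of "{f e}" "ends G e"] by simp
    qed
    have "?U \<subseteq> head G ` (F \<inter> arcs G)"
    proof
      fix v assume "v \<in> ?U"
      then obtain e where "e \<in> set es" "v = f e" using onto by auto
      then show "v \<in> head G ` (F \<inter> arcs G)" using f arc es covers_arc by blast
    qed
    moreover have "?U \<noteq> {}" using len(1,2) by (cases vs) auto
    \<comment> \<open>The head of this entering arc is already covered by a cycle edge, which must
      be \<open>a\<close> itself; but then its tail lies on the cycle.\<close>
    ultimately obtain a where a: "a \<in> F \<inter> arcs G" "head G a \<in> ?U" "tail G a \<notin> ?U"
      using ent[of ?U] UV by (auto simp: entering_def)
    obtain e where e: "e \<in> set es" "head G a = f e" using onto a(2) by auto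
    have "a = e"
      using once[of "head G a" a e] a e f es UV covers_arc by auto
    then show False using a ueU[OF e(1)] underlying_ends_arc by auto
  qed
  then show ?thesis
    using sub once unfolding matching_forest_def underlying_forest_def by blast
qed

section \<open>Exchanging two matching forests\<close>

text \<open>The roots of the branching formed by the arcs of \<open>F\<close>. Isolated vertices
  and, in a matching forest, ends of undirected edges are roots too.\<close>

definition roots where "roots F = V - head G ` (F \<inter> arcs G)"

text \<open>Converse of \<open>matching_forestI\<close>, its last condition phrased with
  \<open>roots\<close>: from here on acyclicity is handled only through cuts.\<close>

lemma matching_forestD:
  assumes "matching_forest G F"
  shows "F \<subseteq> edges G \<union> arcs G"
    and "\<lbrakk>v \<in> V; e \<in> F; f \<in> F; covers G e v; covers G f v\<rbrakk> \<Longrightarrow> e = f"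
    and "\<lbrakk>e \<in> F; e \<in> edges G\<rbrakk> \<Longrightarrow> card (ends G e) = 2"
    and "\<lbrakk>U \<subseteq> V; U \<noteq> {}; roots F \<inter> U = {}\<rbrakk> \<Longrightarrow>
      entering (tail G) (head G) (F \<inter> arcs G) U \<noteq> {}"
proof -
  have F: "F \<subseteq> edges G \<union> arcs G" "underlying_forest G F"
      "\<forall>v\<in>V. \<forall>e\<in>F. \<forall>f\<in>F. covers G e v \<longrightarrow> covers G f v \<longrightarrow> e = f"
    using assms by (simp_all add: matching_forest_def)
  show "F \<subseteq> edges G \<union> arcs G" by (rule F)
  show "\<lbrakk>v \<in> V; e \<in> F; f \<in> F; covers G e v; covers G f v\<rbrakk> \<Longrightarrow> e = f"
    using F(3) by blast
  show "\<lbrakk>e \<in> F; e \<in> edges G\<rbrakk> \<Longrightarrow> card (ends G e) = 2"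
    by (rule forest_no_loop[OF F(2)])
  show "entering (tail G) (head G) (F \<inter> arcs G) U \<noteq> {}"
    if "U \<subseteq> V" "U \<noteq> {}" "roots F \<inter> U = {}"
    using that by (intro forest_entering[OF F(2)]) (auto simp: roots_def)
qed

text \<open>The edge and arc sets of \<open>G\<close> are not assumed finite. Choosing a covered
  vertex for every edge of \<open>F\<close> injects \<open>F\<close> into the finite set
  \<open>V\<close>.\<close>

lemma finite_matching_forest:
  assumes F: "matching_forest G F"
  shows "finite F"
proof -
  have "\<exists>v\<in>V. covers G e v" if "e \<in> F" for e
  proof (cases "e \<in> edges G")
    case True
    then have "ends G e \<noteq> {}" using card_ends by force
    then show ?thesis using True ends_subset[OF True] covers_edge by blast
  next
    case False
    then have "e \<in> arcs G" using matching_forestD(1)[OF F] that by blast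
    then show ?thesis using head_in_verts covers_arc by blast
  qed
  then obtain f where f: "\<And>e. e \<in> F \<Longrightarrow> f e \<in> V \<and> covers G e (f e)" by metis
  then have "inj_on f F" using matching_forestD(2)[OF F] by (metis inj_onI)
  moreover have "f ` F \<subseteq> V" using f by auto
  ultimately show ?thesis using finite_verts inj_on_finite by blast
qed

lemma finite_covered_verts: "finite (covered_verts G F)"
  using finite_verts by (simp add: covered_verts_def)

lemma bij_betw_head:
  assumes F: "matching_forest G F"
  shows "bij_betw (head G) (F \<inter> arcs G) (V - roots F)"
proof -
  have "inj_on (head G) (F \<inter> arcs G)"
  proof (rule inj_onI)
    fix a b assume ab: "a \<in> F \<inter> arcs G" "b \<in> F \<inter> arcs G" "head G a = head G b"
    then show "a = b"
      using matching_forestD(2)[OF F head_in_verts[of a], of a b] by (simp add: covers_arc)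
  qed
  moreover have "head G ` (F \<inter> arcs G) = V - roots F"
    using head_in_verts by (auto simp: roots_def)
  ultimately show ?thesis by (simp add: bij_betw_def)
qed

lemma edge_ends_roots:
  assumes F: "matching_forest G F" and e: "e \<in> F" "e \<in> edges G"
  shows "ends G e \<subseteq> roots F"
proof
  fix v assume v: "v \<in> ends G e"
  then have "v \<in> V" using ends_subset[OF e(2)] by blast
  moreover have "v \<noteq> head G a" if "a \<in> F \<inter> arcs G" for a
    using matching_forestD(2)[OF F \<open>v \<in> V\<close> e(1), of a] covers_arc[of a v] covers_edge[OF e(2)] v
      that e(2) edges_arcs_disjoint by auto
  ultimately show "v \<in> roots F" by (auto simp: roots_def)
qed

lemma covered_verts_iff:
  assumes "F \<subseteq> edges G \<union> arcs G"
  shows "v \<in> covered_verts G F \<longleftrightarrow>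
    (\<exists>e\<in>F \<inter> edges G. v \<in> ends G e) \<or> v \<in> head G ` (F \<inter> arcs G)"
proof -
  have "(\<exists>e\<in>F. covers G e v) \<longleftrightarrow>
      (\<exists>e\<in>F \<inter> edges G. v \<in> ends G e) \<or> v \<in> head G ` (F \<inter> arcs G)"
    using assms by (auto simp: covers_def)
  moreover have "v \<in> V" if "covers G e v" for e
    using that ends_subset head_in_verts by (auto simp: covers_def)
  ultimately show ?thesis by (auto simp: covered_verts_def)
qed

text \<open>Edmonds' theorem supplies branchings for the root sets exchanged on \<open>X\<close>.
  The undirected edges are exchanged along with the roots, so their ends never become heads of arcs
  in the same forest.\<close>

lemma swap_matching_forests:
  fixes F :: "bool \<Rightarrow> 'e set"
  assumes mf: "\<And>i. matching_forest G (F i)" and disj: "F True \<inter> F False = {}"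
    and X: "\<And>i e. \<lbrakk>e \<in> F i; e \<in> edges G\<rbrakk> \<Longrightarrow> ends G e \<subseteq> X \<or> ends G e \<inter> X = {}"
    and src: "\<And>U i. \<lbrakk>U \<subseteq> V; U \<noteq> {};
        entering (tail G) (head G) ((F True \<union> F False) \<inter> arcs G) U = {}\<rbrakk> \<Longrightarrow>
      (roots (F i) - X \<union> roots (F (\<not> i)) \<inter> X) \<inter> U \<noteq> {}"
  shows "\<exists>F'. (\<forall>i. matching_forest G (F' i)) \<and> F' True \<inter> F' False = {} \<and>
    F' True \<union> F' False = F True \<union> F False \<and>
    (\<forall>i. covered_verts G (F' i) = covered_verts G (F i) - X \<union> covered_verts G (F (\<not> i)) \<inter> X)"
proof -
  define R' where "R' i = roots (F i) - X \<union> roots (F (\<not> i)) \<inter> X" for i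
  define A where "A = (F True \<union> F False) \<inter> arcs G"
  let ?ent = "entering (tail G) (head G)"
  have finA: "finite A" using finite_matching_forest[OF mf] by (simp add: A_def)
  have sub: "F i \<subseteq> edges G \<union> arcs G" for i using matching_forestD(1)[OF mf] .
  have "\<exists>B. (\<forall>i\<in>UNIV. B i \<subseteq> A \<and> rooted_branching (tail G) (head G) V (R' i) (B i)) \<and>
      disjoint_family_on B (UNIV :: bool set)"
  proof (rule edmonds_disjoint_branchings[OF finite_verts _ finA])
    show "tail G a \<in> V \<and> head G a \<in> V" if "a \<in> A" for a
      using that tail_in_verts head_in_verts by (simp add: A_def)
    show "R' i \<subseteq> V" for i by (auto simp: R'_def roots_def)
    show "card {i \<in> UNIV. R' i \<inter> U = {}} \<le> card (?ent A U)" if U: "U \<subseteq> V" "U \<noteq> {}" for U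
    proof (cases "\<exists>i. R' i \<inter> U \<noteq> {}")
      case True
      then obtain i where i: "R' i \<inter> U \<noteq> {}" by blast
      have le: "{j \<in> UNIV. R' j \<inter> U = {}} \<subseteq> {\<not> i}" using i by auto
      show ?thesis
      proof (cases "R' (\<not> i) \<inter> U = {}")
        case True
        then have "?ent A U \<noteq> {}" using src[OF U] unfolding R'_def A_def by blast
        then have "card (?ent A U) > 0" using finite_entering[OF finA] by (simp add: card_gt_0_iff)
        moreover have "card {j \<in> UNIV. R' j \<inter> U = {}} \<le> card {\<not> i}"
          by (rule card_mono[OF _ le]) simp
        ultimately show ?thesis by simp
      next
        case False
        then have "{j \<in> UNIV. R' j \<inter> U = {}} = {}" using le by blast
        then show ?thesis by (metis card.empty le0)
      qed
    next
      case False
      then have no: "v \<notin> R' i" if "v \<in> U" for i v using that by blast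
      \<comment> \<open>The exchange only permutes the two root sets at each vertex, so
        \<open>U\<close> avoids the old ones as well. Both old branchings enter \<open>U\<close>, by
        different arcs.\<close>
      have "roots (F i) \<inter> U = {}" for i
        using no[of _ i] no[of _ "\<not> i"] unfolding R'_def by auto
      then have "?ent (F i \<inter> arcs G) U \<noteq> {}" for i
        using matching_forestD(4)[OF mf U] by blast
      then obtain a b where "a \<in> ?ent (F True \<inter> arcs G) U" "b \<in> ?ent (F False \<inter> arcs G) U"
        by blast
      then have "a \<noteq> b" "{a, b} \<subseteq> ?ent A U" using disj by (auto simp: entering_def A_def)
      then have "2 \<le> card (?ent A U)"
        using card_mono[OF finite_entering[OF finA], of "{a, b}"] by (metis card_2_iff)
      moreover have "card {i \<in> UNIV. R' i \<inter> U = {}} \<le> card (UNIV :: bool set)"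
        by (intro card_mono) auto
      ultimately show ?thesis by simp
    qed
  qed simp
  then obtain B where B: "\<And>i. B i \<subseteq> A" "\<And>i. rooted_branching (tail G) (head G) V (R' i) (B i)"
    and Bfam: "disjoint_family_on B (UNIV :: bool set)" by blast
  have Bdisj: "B True \<inter> B False = {}"
    by (rule disjoint_family_onD[OF Bfam]) simp_all
  have Bbij: "bij_betw (head G) (B i) (V - R' i)" for i
    using B(2) by (simp add: rooted_branching_def)
  have VR': "V - R' i = (V - roots (F i)) - X \<union> (V - roots (F (\<not> i))) \<inter> X" for i
    by (auto simp: R'_def)
  \<comment> \<open>A branching has one arc per vertex that is not a root, and the exchange
    preserves the total number of these; so no arc of \<open>A\<close> is left over.\<close>
  have "B True \<union> B False = A"
  proof (rule card_subset_eq[OF finA])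
    show "B True \<union> B False \<subseteq> A" using B(1) by blast
    have "card (B True \<union> B False) = card (B True) + card (B False)"
      using B(1) finA finite_subset Bdisj by (metis card_Un_disjoint)
    also have "\<dots> = card (V - R' True) + card (V - R' False)"
      by (simp add: bij_betw_same_card[OF Bbij])
    also have "\<dots> = card (V - roots (F True)) + card (V - roots (F False))"
      using card_exchange[of "V - roots (F True)" "V - roots (F False)" X]
        card_exchange[of "V - roots (F False)" "V - roots (F True)" X] finite_verts
      by (simp add: VR')
    also have "\<dots> = card (F True \<inter> arcs G) + card (F False \<inter> arcs G)"
      by (simp add: bij_betw_same_card[OF bij_betw_head[OF mf]])
    also have "\<dots> = card A"
      using disj finite_matching_forest[OF mf] unfolding A_def Int_Un_distrib2
      by (intro card_Un_disjoint[symmetric]) auto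
    finally show "card (B True \<union> B False) = card A" .
  qed
  define M where "M i = {e \<in> F i \<inter> edges G. ends G e \<inter> X = {}} \<union>
    {e \<in> F (\<not> i) \<inter> edges G. ends G e \<subseteq> X}" for i
  define F' where "F' i = M i \<union> B i" for i
  have ME: "M i \<subseteq> edges G" for i by (auto simp: M_def)
  have BA: "B i \<subseteq> arcs G" for i using B(1)[of i] by (auto simp: A_def)
  have F'edges: "F' i \<inter> edges G = M i" and F'arcs: "F' i \<inter> arcs G = B i" for i
    using ME[of i] BA[of i] edges_arcs_disjoint by (auto simp: F'_def)
  have nonempty: "ends G e \<noteq> {}" if "e \<in> edges G" for e using card_ends[OF that] by force
  have Mv: "(v \<in> X \<longrightarrow> e \<in> F (\<not> i)) \<and> (v \<notin> X \<longrightarrow> e \<in> F i)" if "e \<in> M i" "v \<in> ends G e" for e v i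
    using that by (auto simp: M_def)
  have mf': "matching_forest G (F' i)" for i
  proof (rule matching_forestI)
    show "F' i \<subseteq> edges G \<union> arcs G" using ME BA by (auto simp: F'_def)
    show "card (ends G e) = 2" if "e \<in> F' i" "e \<in> edges G" for e
    proof -
      have "e \<in> M i" using that F'edges by blast
      then show ?thesis using matching_forestD(3)[OF mf] by (auto simp: M_def)
    qed
    \<comment> \<open>An end of an undirected edge is a root in the forest the edge comes from, and
      the exchange moves edge and root together.\<close>
    have MR: "v \<in> R' i" if "e \<in> M i" "v \<in> ends G e" for e v
      using Mv[OF that] that ME[of i] edge_ends_roots[OF mf] unfolding R'_def by (cases "v \<in> X") blast+
    show "e = f" if "v \<in> V" "e \<in> F' i" "f \<in> F' i" "covers G e v" "covers G f v" for v e f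
    proof -
      have MB: False if "e \<in> M i" "f \<in> B i" "covers G e v" "covers G f v" for e f
      proof -
        have "v \<in> ends G e" using that ME[of i] covers_edge by blast
        then have "v \<in> R' i" using MR that by blast
        moreover have "v = head G f" using that BA[of i] covers_arc by blast
        ultimately show False using that Bbij[of i] by (auto simp: bij_betw_def)
      qed
      have MM: "e = f" if "e \<in> M i" "f \<in> M i"
      proof -
        have "v \<in> ends G e" "v \<in> ends G f"
          using that ME[of i] \<open>covers G e v\<close> \<open>covers G f v\<close> covers_edge by blast+
        then show ?thesis
          using Mv[of e i v] Mv[of f i v] matching_forestD(2)[OF mf \<open>v \<in> V\<close> _ _ \<open>covers G e v\<close> \<open>covers G f v\<close>]
            that by blast
      qed
      have BB: "e = f" if "e \<in> B i" "f \<in> B i"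
      proof -
        have "v = head G e" "v = head G f"
          using that BA[of i] \<open>covers G e v\<close> \<open>covers G f v\<close> covers_arc by blast+
        then show ?thesis using Bbij[of i] that by (auto simp: bij_betw_def inj_on_def)
      qed
      show ?thesis using that MB MM BB unfolding F'_def by blast
    qed
    show "?ent (F' i \<inter> arcs G) U \<noteq> {}"
      if "U \<noteq> {}" "U \<subseteq> V" "U \<subseteq> head G ` (F' i \<inter> arcs G)" for U
    proof -
      have "U \<subseteq> V - R' i" using that F'arcs[of i] Bbij[of i] by (simp add: bij_betw_def)
      then show ?thesis using that B(2)[of i] F'arcs[of i] by (simp add: rooted_branching_def)
    qed
  qed
  have "F' True \<inter> F' False = {}"
  proof -
    \<comment> \<open>Nonempty ends matter: no edge is both inside \<open>X\<close> and disjoint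
      from it.\<close>
    have "M True \<inter> M False = {}" using disj nonempty by (auto simp: M_def)
    then show ?thesis using Bdisj ME BA edges_arcs_disjoint unfolding F'_def by blast
  qed
  moreover have "F' True \<union> F' False = F True \<union> F False"
  proof -
    have "M True \<union> M False = (F True \<union> F False) \<inter> edges G"
      using X[of _ True] X[of _ False] by (auto simp: M_def)
    then show ?thesis
      using \<open>B True \<union> B False = A\<close> sub[of True] sub[of False] unfolding F'_def A_def by blast
  qed
  moreover have "covered_verts G (F' i) =
      covered_verts G (F i) - X \<union> covered_verts G (F (\<not> i)) \<inter> X" for i
  proof -
    have "v \<in> covered_verts G (F' i) \<longleftrightarrow>
        v \<in> covered_verts G (F i) - X \<union> covered_verts G (F (\<not> i)) \<inter> X" for v
    proof -
      have hd: "head G ` (F j \<inter> arcs G) = V - roots (F j)" for j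
        using bij_betw_head[OF mf] by (simp add: bij_betw_def)
      have "(\<exists>e\<in>M i. v \<in> ends G e) \<longleftrightarrow> (v \<notin> X \<and> (\<exists>e\<in>F i \<inter> edges G. v \<in> ends G e)) \<or>
          (v \<in> X \<and> (\<exists>e\<in>F (\<not> i) \<inter> edges G. v \<in> ends G e))"
        using X[of _ i] X[of _ "\<not> i"] unfolding M_def by blast
      moreover have "v \<in> head G ` B i \<longleftrightarrow> (v \<notin> X \<and> v \<in> head G ` (F i \<inter> arcs G)) \<or>
          (v \<in> X \<and> v \<in> head G ` (F (\<not> i) \<inter> arcs G))"
        using Bbij[of i] unfolding bij_betw_def hd VR' by blast
      ultimately show ?thesis
        unfolding Un_iff Diff_iff Int_iff covered_verts_iff[OF matching_forestD(1)[OF mf']]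
          covered_verts_iff[OF matching_forestD(1)[OF mf]] F'edges F'arcs by blast
    qed
    then show ?thesis by blast
  qed
  ultimately show ?thesis using mf' by blast
qed

text \<open>The exchange lowers the larger number of covered vertices by \<open>sum s X\<close>,
  which is 1 or 2, and raises the smaller one by as much. With a gap of at least 3, both new numbers
  lie strictly between the old ones.\<close>

lemma balance_matching_forests:
  fixes F :: "bool \<Rightarrow> 'e set"
  assumes mf: "\<And>i. matching_forest G (F i)" and disj: "F True \<inter> F False = {}"
    and gap: "card (covered_verts G (F True)) \<ge> card (covered_verts G (F False)) + 3"
  shows "\<exists>F'. (\<forall>i. matching_forest G (F' i)) \<and> F' True \<inter> F' False = {} \<and>
    F' True \<union> F' False = F True \<union> F False \<and>
    card (covered_verts G (F' True)) + card (covered_verts G (F' False))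
      = card (covered_verts G (F True)) + card (covered_verts G (F False)) \<and>
    card (covered_verts G (F False)) < card (covered_verts G (F' True)) \<and>
    card (covered_verts G (F' True)) < card (covered_verts G (F True))"
proof -
  let ?A = "(F True \<union> F False) \<inter> arcs G" and ?C = "\<lambda>i. covered_verts G (F i)"
  have meet: "roots (F i) \<inter> U \<noteq> {}"
    if U: "U \<subseteq> V" "U \<noteq> {}" "entering (tail G) (head G) ?A U = {}" for U i
  proof
    assume "roots (F i) \<inter> U = {}"
    then obtain a where "a \<in> entering (tail G) (head G) (F i \<inter> arcs G) U"
      using matching_forestD(4)[OF mf U(1,2)] by blast
    then have "a \<in> entering (tail G) (head G) ?A U"
      by (cases i) (auto simp: entering_def)
    then show False using U(3) by blast
  qed
  have "\<exists>N. disjoint N \<and> (\<forall>P\<in>N. \<exists>u\<in>V. \<exists>w\<in>V. P = {u, w} \<and>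
        u \<in> roots (F True) - roots (F False) \<and> w \<in> roots (F False) - roots (F True)) \<and>
      (\<forall>X U i. (\<forall>P\<in>N. P \<subseteq> X \<or> P \<inter> X = {}) \<longrightarrow> U \<subseteq> V \<longrightarrow> U \<noteq> {} \<longrightarrow>
        entering (tail G) (head G) ?A U = {} \<longrightarrow>
        (roots (F i) - X \<union> roots (F (\<not> i)) \<inter> X) \<inter> U \<noteq> {})"
    by (rule root_pairs_exist[OF finite_verts meet])
  then obtain N where N: "disjoint N"
    and pair: "\<forall>P\<in>N. \<exists>u\<in>V. \<exists>w\<in>V. P = {u, w} \<and>
      u \<in> roots (F True) - roots (F False) \<and> w \<in> roots (F False) - roots (F True)"
    and safe: "\<forall>X U i. (\<forall>P\<in>N. P \<subseteq> X \<or> P \<inter> X = {}) \<longrightarrow> U \<subseteq> V \<longrightarrow> U \<noteq> {} \<longrightarrow>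
      entering (tail G) (head G) ?A U = {} \<longrightarrow>
      (roots (F i) - X \<union> roots (F (\<not> i)) \<inter> X) \<inter> U \<noteq> {}"
    by (elim exE conjE)
  \<comment> \<open>Edges are represented by their vertex sets, so parallel ones are identified;
    this can only lower degrees.\<close>
  define H where "H = ends G ` ((F True \<union> F False) \<inter> edges G) \<union> N"
  define s :: "'v \<Rightarrow> int" where "s v = of_bool (v \<in> ?C True) - of_bool (v \<in> ?C False)" for v
  have CV: "?C i \<subseteq> V" for i by (auto simp: covered_verts_def)
  have finC: "finite (?C i)" for i by (rule finite_covered_verts)
  have sum_s: "sum s X = int (card (?C True \<inter> X)) - int (card (?C False \<inter> X))" if "X \<subseteq> V" for X
  proof -
    have "finite X" using that finite_verts finite_subset by blast
    then show ?thesis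
      by (simp add: s_def sum_subtractf Int_commute)
  qed
  have "\<exists>X\<subseteq>V. (\<forall>P\<in>H. P \<subseteq> X \<or> P \<inter> X = {}) \<and> 0 < sum s X \<and> sum s X \<le> 2"
  proof (rule closed_set_small_sum[OF finite_verts])
    have two: "P \<subseteq> V \<and> card P = 2" if "P \<in> H" for P
    proof (cases "P \<in> N")
      case True
      then obtain u w where "P = {u, w}" "u \<in> V" "w \<in> V" "u \<noteq> w" using pair by blast
      then show ?thesis by simp
    next
      case False
      then obtain i e where "e \<in> F i" "e \<in> edges G" "P = ends G e"
        using \<open>P \<in> H\<close> unfolding H_def by blast
      then show ?thesis using matching_forestD(3)[OF mf] ends_subset by blast
    qed
    then show "P \<subseteq> V \<and> card P = 2" if "P \<in> H" for P using that .
    show "finite H" using two finite_verts by (meson PowI finite_Pow_iff finite_subset subsetI)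
    show "0 < sum s V"
      using gap CV by (simp add: sum_s Int_absorb2)
    show "int (card {P \<in> H. v \<in> P}) + \<bar>s v\<bar> \<le> 2" if v: "v \<in> V" for v
    proof -
      define E where "E i = {e \<in> F i \<inter> edges G. v \<in> ends G e}" for i
      define Nv where "Nv = {P \<in> N. v \<in> P}"
      have E1: "\<exists>e. E i \<subseteq> {e}" for i
      proof -
        have "e = f" if "e \<in> E i" "f \<in> E i" for e f
          using matching_forestD(2)[OF mf v, of e i f] that by (simp add: E_def covers_edge)
        then show ?thesis by blast
      qed
      have finE: "finite (E i)" "card (E i) \<le> 1" for i
      proof -
        obtain e where e: "E i \<subseteq> {e}" using E1 by blast
        show "finite (E i)" using finite_subset[OF e] by simp
        show "card (E i) \<le> 1" using card_mono[OF _ e] by simp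
      qed
      have "\<exists>P. Nv \<subseteq> {P}"
      proof -
        have "P = Q" if "P \<in> Nv" "Q \<in> Nv" for P Q
          using N that unfolding Nv_def disjoint_def by blast
        then show ?thesis by blast
      qed
      then obtain P where P: "Nv \<subseteq> {P}" by blast
      have finN: "finite Nv" "card Nv \<le> 1"
        using finite_subset[OF P] card_mono[OF _ P] by simp_all
      have N0: "Nv = {}" if same: "v \<in> roots (F True) \<longleftrightarrow> v \<in> roots (F False)"
      proof (rule equals0I)
        fix P assume "P \<in> Nv"
        then have "P \<in> N" "v \<in> P" by (simp_all add: Nv_def)
        from bspec[OF pair \<open>P \<in> N\<close>] obtain u w where "P = {u, w}"
          "u \<in> roots (F True) - roots (F False)" "w \<in> roots (F False) - roots (F True)"
          by (elim bexE conjE)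
        then show False using same \<open>v \<in> P\<close> by auto
      qed
      have E0: "E i = {}" if "v \<notin> roots (F i)" for i
        using edge_ends_roots[OF mf] that unfolding E_def by blast
      have Cv: "v \<in> ?C i \<longleftrightarrow> E i \<noteq> {} \<or> v \<notin> roots (F i)" for i
        unfolding covered_verts_iff[OF matching_forestD(1)[OF mf]] using v
        by (auto simp: E_def roots_def)
      have "{P \<in> H. v \<in> P} \<subseteq> (ends G ` E True \<union> ends G ` E False) \<union> Nv"
        by (auto simp: H_def E_def Nv_def)
      then have "card {P \<in> H. v \<in> P} \<le> card ((ends G ` E True \<union> ends G ` E False) \<union> Nv)"
        using finE finN by (intro card_mono) auto
      also have "\<dots> \<le> card (ends G ` E True \<union> ends G ` E False) + card Nv"
        by (rule card_Un_le)
      also have "\<dots> \<le> card (ends G ` E True) + card (ends G ` E False) + card Nv"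
        by (intro add_right_mono card_Un_le)
      also have "\<dots> \<le> card (E True) + card (E False) + card Nv"
        using finE by (intro add_right_mono add_mono card_image_le) auto
      finally have deg: "card {P \<in> H. v \<in> P} \<le> card (E True) + card (E False) + card Nv" .
      have cE: "card (E i) = of_bool (E i \<noteq> {})" for i
      proof (cases "E i = {}")
        case False
        then have "card (E i) > 0" using finE(1) by (simp add: card_gt_0_iff)
        then show ?thesis using False finE(2)[of i] by simp
      qed simp
      \<comment> \<open>A root of both forests lies in no pair, and an edge of exactly one forest
        there gives degree at most one and weight one. A root of only one forest is covered by an
        arc of the other, so its weight vanishes once it has an undirected edge next to its possible
        pair. A root of neither has degree and weight zero.\<close>
      show ?thesis
      proof (cases "v \<in> roots (F True)"; cases "v \<in> roots (F False)")
        assume r: "v \<in> roots (F True)" "v \<in> roots (F False)"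
        then have "Nv = {}" using N0 by blast
        then show ?thesis using deg r
          by (cases "E True = {}"; cases "E False = {}"; simp add: s_def Cv cE)
      next
        assume r: "v \<in> roots (F True)" "v \<notin> roots (F False)"
        then have "E False = {}" using E0 by blast
        then show ?thesis using deg r finN(2)
          by (cases "E True = {}"; simp add: s_def Cv cE)
      next
        assume r: "v \<notin> roots (F True)" "v \<in> roots (F False)"
        then have "E True = {}" using E0 by blast
        then show ?thesis using deg r finN(2)
          by (cases "E False = {}"; simp add: s_def Cv cE)
      next
        assume r: "v \<notin> roots (F True)" "v \<notin> roots (F False)"
        then have "E True = {}" "E False = {}" "Nv = {}" using E0 N0 by blast+
        then show ?thesis using deg r by (simp add: s_def Cv)
      qed
    qed
  qed
  then obtain X where X: "X \<subseteq> V" "\<forall>P\<in>H. P \<subseteq> X \<or> P \<inter> X = {}" "0 < sum s X" "sum s X \<le> 2"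
    by blast
  have "\<exists>F'. (\<forall>i. matching_forest G (F' i)) \<and> F' True \<inter> F' False = {} \<and>
    F' True \<union> F' False = F True \<union> F False \<and>
    (\<forall>i. covered_verts G (F' i) = ?C i - X \<union> ?C (\<not> i) \<inter> X)"
  proof (rule swap_matching_forests[OF mf disj])
    show "ends G e \<subseteq> X \<or> ends G e \<inter> X = {}" if "e \<in> F i" "e \<in> edges G" for i e
    proof -
      have "e \<in> F True \<union> F False" using that(1) by (cases i) auto
      then have "ends G e \<in> H" using that(2) by (auto simp: H_def)
      then show ?thesis using X(2) by blast
    qed
    have "\<forall>P\<in>N. P \<subseteq> X \<or> P \<inter> X = {}" using X(2) by (simp add: H_def)
    then show "(roots (F i) - X \<union> roots (F (\<not> i)) \<inter> X) \<inter> U \<noteq> {}"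
      if "U \<subseteq> V" "U \<noteq> {}" "entering (tail G) (head G) ?A U = {}" for U i
      using safe that by blast
  qed
  then obtain F' where F': "\<forall>i. matching_forest G (F' i)" "F' True \<inter> F' False = {}"
    "F' True \<union> F' False = F True \<union> F False"
    and cov: "\<And>i. covered_verts G (F' i) = ?C i - X \<union> ?C (\<not> i) \<inter> X"
    by blast
  have "card (covered_verts G (F' True)) + card (?C True \<inter> X) = card (?C True) + card (?C False \<inter> X)"
    "card (covered_verts G (F' False)) + card (?C False \<inter> X) = card (?C False) + card (?C True \<inter> X)"
    using card_exchange[OF finC finC, of True X False] card_exchange[OF finC finC, of False X True]
    by (simp_all add: cov)
  then show ?thesis
    using F' sum_s[OF X(1)] X(3,4) gap by (intro exI[of _ F']) simp
qed

end

section \<open>Minimising the sum of squares over all partitions\<close>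

theorem theorem1p5:
  fixes G :: "('v, 'e) mixed_graph" and k :: nat
  assumes "wf_mixed_graph G"
    and "k > 0"
    and "\<exists>F. matching_forest_partition G k F"
  shows "\<exists>F. matching_forest_partition G k F \<and>
           (\<forall>i\<in>{1..k}. \<forall>j\<in>{1..k}.
              \<bar>int (card (covered_verts G (F i))) - int (card (covered_verts G (F j)))\<bar> \<le> 2)"
proof -
  interpret wf_mixed_graph G by (rule assms(1))
  let ?c = "\<lambda>F. card (covered_verts G F)"
  obtain F where F: "matching_forest_partition G k F"
    and min: "\<And>F'. matching_forest_partition G k F' \<Longrightarrow>
      (\<Sum>i\<in>{1..k}. (?c (F i))\<^sup>2) \<le> (\<Sum>i\<in>{1..k}. (?c (F' i))\<^sup>2)"
    using assms(3) ex_has_least_nat[of "matching_forest_partition G k" _ "\<lambda>F. \<Sum>i\<in>{1..k}. (?c (F i))\<^sup>2"]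
    by metis
  have mf: "\<And>i. i \<in> {1..k} \<Longrightarrow> matching_forest G (F i)" and disj: "disjoint_family_on F {1..k}"
    and un: "(\<Union>i\<in>{1..k}. F i) = edges G \<union> arcs G"
    using F by (auto simp: matching_forest_partition_def)
  have small: "?c (F i) \<le> ?c (F j) + 2" if ij: "i \<in> {1..k}" "j \<in> {1..k}" for i j
  proof (rule ccontr)
    assume big: "\<not> ?c (F i) \<le> ?c (F j) + 2"
    then have "i \<noteq> j" by auto
    have "\<exists>D. (\<forall>b. matching_forest G (D b)) \<and> D True \<inter> D False = {} \<and>
      D True \<union> D False = F i \<union> F j \<and> ?c (D True) + ?c (D False) = ?c (F i) + ?c (F j) \<and>
      ?c (F j) < ?c (D True) \<and> ?c (D True) < ?c (F i)"
      using balance_matching_forests[of "\<lambda>b. if b then F i else F j"] mf ij big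
        disjoint_family_onD[OF disj ij \<open>i \<noteq> j\<close>] by simp
    then obtain D where D: "\<And>b. matching_forest G (D b)" "D True \<inter> D False = {}"
      "D True \<union> D False = F i \<union> F j" and c: "?c (D True) + ?c (D False) = ?c (F i) + ?c (F j)"
      "?c (F j) < ?c (D True)" "?c (D True) < ?c (F i)" by blast
    define F' where "F' = F(i := D True, j := D False)"
    have F'ij: "F' i = D True" "F' j = D False" using \<open>i \<noteq> j\<close> by (auto simp: F'_def)
    have rest: "F' l = F l" if "l \<noteq> i" "l \<noteq> j" for l using that by (simp add: F'_def)
    have split: "{1..k} = insert i (insert j ({1..k} - {i, j}))" using ij by auto
    have "matching_forest_partition G k F'"
      unfolding matching_forest_partition_def
    proof (intro conjI ballI)
      show "matching_forest G (F' l)" if "l \<in> {1..k}" for l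
        using D(1) mf[OF that] by (simp add: F'_def)
      have apart: "F l \<inter> (F i \<union> F j) = {}" if "l \<in> {1..k}" "l \<noteq> i" "l \<noteq> j" for l
        using disjoint_family_onD[OF disj that(1)] that ij by blast
      show "disjoint_family_on F' {1..k}"
        unfolding disjoint_family_on_def
      proof (intro ballI impI)
        fix l m assume lm: "l \<in> {1..k}" "m \<in> {1..k}" "l \<noteq> m"
        have sub: "F' i \<subseteq> F i \<union> F j" "F' j \<subseteq> F i \<union> F j" using D(3) F'ij by auto
        consider "l \<in> {i, j}" "m \<in> {i, j}" | "l \<in> {i, j}" "m \<notin> {i, j}" | "l \<notin> {i, j}" "m \<in> {i, j}"
          | "l \<notin> {i, j}" "m \<notin> {i, j}" by blast
        then show "F' l \<inter> F' m = {}"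
        proof cases
          case 1
          then show ?thesis using D(2) F'ij lm(3) by auto
        next
          case 2
          then show ?thesis using apart[of m] lm rest[of m] sub by blast
        next
          case 3
          then show ?thesis using apart[of l] lm rest[of l] sub by blast
        next
          case 4
          then show ?thesis using disjoint_family_onD[OF disj lm] rest by simp
        qed
      qed
      have "(\<Union>l\<in>{1..k}. F' l) = F' i \<union> F' j \<union> (\<Union>l\<in>{1..k} - {i, j}. F' l)"
        by (subst split) auto
      also have "\<dots> = F i \<union> F j \<union> (\<Union>l\<in>{1..k} - {i, j}. F l)"
        using D(3) F'ij rest by simp
      also have "\<dots> = (\<Union>l\<in>{1..k}. F l)"
        by (subst (2) split) auto
      finally show "(\<Union>l\<in>{1..k}. F' l) = edges G \<union> arcs G" using un by simp
    qed
    then have "(\<Sum>l\<in>{1..k}. (?c (F l))\<^sup>2) \<le> (\<Sum>l\<in>{1..k}. (?c (F' l))\<^sup>2)" by (rule min)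
    moreover have sum_split: "(\<Sum>l\<in>{1..k}. (?c (T l))\<^sup>2) =
        (?c (T i))\<^sup>2 + (?c (T j))\<^sup>2 + (\<Sum>l\<in>{1..k} - {i, j}. (?c (T l))\<^sup>2)" for T
      using \<open>i \<noteq> j\<close> by (subst split) simp
    moreover have "(\<Sum>l\<in>{1..k} - {i, j}. (?c (F' l))\<^sup>2) = (\<Sum>l\<in>{1..k} - {i, j}. (?c (F l))\<^sup>2)"
      using rest by (intro sum.cong) auto
    ultimately have le: "(?c (F i))\<^sup>2 + (?c (F j))\<^sup>2 \<le> (?c (D True))\<^sup>2 + (?c (D False))\<^sup>2"
      by (simp add: F'ij)
    \<comment> \<open>With \<open>a = ?c (D True)\<close> and \<open>b = ?c (F j)\<close>, the sum
      of squares falls from \<open>(a + d)^2 + b^2\<close> to \<open>a^2 + (b + d)^2\<close>, that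
      is by \<open>2 * d * (a - b) > 0\<close>, against minimality.\<close>
    define d where "d = ?c (F i) - ?c (D True)"
    have d: "?c (F i) = ?c (D True) + d" "?c (D False) = ?c (F j) + d" "d > 0"
      using c by (auto simp: d_def)
    have "d * ?c (D True) + d * ?c (D True) \<le> d * ?c (F j) + d * ?c (F j)"
      using le unfolding d by (simp add: power2_eq_square algebra_simps)
    moreover have "d * ?c (F j) < d * ?c (D True)" using c(2) d(3) by simp
    ultimately show False by linarith
  qed
  have "\<bar>int (?c (F i)) - int (?c (F j))\<bar> \<le> 2" if "i \<in> {1..k}" "j \<in> {1..k}" for i j
    using small[OF that] small[OF that(2,1)] by linarith
  then show ?thesis using F by blast
qed

end
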